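(* Let $\alpha>0$, and let the setting be that of the context. (i) Consider an $\mathcal{F}^{(\alpha)}$-family $p(x,\xi)=(1+\alpha\xi\cdot h(x))^{-1/\alpha}e^{\varphi(\xi)}$, $\xi\in\Omega$, with potential function $\varphi(\xi)=-\log\int(1+\alpha\xi\cdot h)^{-1/\alpha}d\mu$. Then the $L^{(\alpha)}$-divergence of $\varphi$ is the Rényi divergence of order $\tilde\alpha:=1+\alpha$: $$\mathbf{D}^{(\alpha)}[\xi:\xi']=\mathbf{D}_{\tilde\alpha}\big(p(\cdot,\xi')\,||\,p(\cdot,\xi)\big),\qquad\xi,\xi'\in\Omega.$$ Moreover, the $\alpha$-conjugate $\psi$ of $\varphi$ is the Rényi entropy of order $\tilde\alpha$: $\psi(\eta)=\mathbf{H}_{\tilde\alpha}(p(\cdot,\xi))$ for $\eta=D^{(\alpha)}\varphi(\xi)$. (ii) Consider an $\mathcal{F}^{(-\alpha)}$-family $p(x,\xi)=(1+\alpha\xi\cdot h(x))^{1/\alpha}e^{-\varphi(\xi)}$, $\xi\in\Omega$, with potential function $\varphi(\xi)=\log\int(1+\alpha\xi\cdot h)^{1/\alpha}d\mu$. If $0<\alpha<1$, the $L^{(-\alpha)}$-divergence of $\varphi$ is the Rényi divergence of order $\tilde\alpha:=1-\alpha$: $$\mathbf{D}^{(-\alpha)}[\xi:\xi']=\mathbf{D}_{\tilde\alpha}\big(p(\cdot,\xi')\,||\,p(\cdot,\xi)\big),$$ and the $(-\alpha)$-conjugate is $\psi(\eta)=-\mathbf{H}_{\tilde\alpha}(p(\cdot,\xi))$,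 $\eta=D^{(\alpha)}\varphi(\xi)$. If $\alpha>1$, the $L^{(\alpha)}$-divergence of $\varphi$ is $$\mathbf{D}^{(\alpha)}[\xi:\xi']=\frac{\alpha-1}{\alpha}\,\mathbf{D}_{\alpha}\big(p(\cdot,\xi)\,||\,p(\cdot,\xi')\big),$$ and the conjugate is $\psi(\eta)=-\frac1\alpha\log\int p(x,\xi)^{1-\alpha}d\mu(x)$, $\eta=D^{(\alpha)}\varphi(\xi)$.
   Context: Setting: $\mu$ is a probability measure on a measurable space $\mathcal{X}$; $h=(h^1,\dots,h^d):\mathcal{X}\to(0,\infty)^d$ is measurable and such that $\xi\cdot h=\xi'\cdot h$ $\mu$-a.e. implies $\xi=\xi'$. $\Omega\subset\mathbb{R}^d$ is an open convex set such that for all $\xi\in\Omega$: $1+\alpha\xi\cdot h>0$, the integral defining $\varphi(\xi)$ is finite, and one can differentiate it with respect to $\xi$ under the integral sign (as many times as needed). Densities are with respect to $\mu$. $D$ is the Euclidean gradient. $\mathbf{D}^{(\alpha)}[\xi:\xi']=\frac1\alpha\log(1+\alpha D\varphi(\xi')\cdot(\xi-\xi'))-(\varphi(\xi)-\varphi(\xi'))$ and $\mathbf{D}^{(-\alpha)}[\xi:\xi']=(\varphi(\xi)-\varphi(\xi'))-\frac1\alpha\log(1+\alpha D\varphi(\xi')\cdot(\xi-\xi'))$. $\alpha$-gradient: $D^{(\alpha)}\varphi(\xi)=\frac{D\varphi(\xi)}{1-\alpha D\varphi(\xi)\cdot\xi}$. The $\alpha$-conjugate (and likewise the $(-\alpha)$-conjugate)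 $\psi$ is defined on the range of $D^{(\alpha)}\varphi$ by $\psi(\eta)=\frac1\alpha\log(1+\alpha\xi\cdot\eta)-\varphi(\xi)$, $\eta=D^{(\alpha)}\varphi(\xi)$. For $\tilde\alpha\in(0,1)\cup(1,\infty)$ and probability densities $p,q$ with respect to $\mu$: Rényi entropy $\mathbf{H}_{\tilde\alpha}(p)=\frac1{1-\tilde\alpha}\log\int p^{\tilde\alpha}d\mu$; Rényi divergence $\mathbf{D}_{\tilde\alpha}(p||q)=\frac1{\tilde\alpha-1}\log\int p^{\tilde\alpha}q^{1-\tilde\alpha}d\mu$. *)

theory Defs
  imports "HOL-Probability.Probability"
begin

definition gradient :: "('a::real_inner \<Rightarrow> real) \<Rightarrow> 'a \<Rightarrow> 'a" where
  "gradient f \<xi> = (THE v. GDERIV f \<xi> :> v)"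

text \<open>The integrals below are Bochner integrals, so the gradient of the integral is the
  vector-valued integral of the gradient of the integrand. The first clause makes the gradient of
  the integrand meaningful.\<close>

definition diff_under_integral ::
  "'x measure \<Rightarrow> ('a::euclidean_space \<Rightarrow> 'x \<Rightarrow> real) \<Rightarrow> 'a set \<Rightarrow> bool" where
  "diff_under_integral M f \<Omega> \<longleftrightarrow>
     (\<forall>\<xi>\<in>\<Omega>.
        (\<forall>x\<in>space M. (\<lambda>\<zeta>. f \<zeta> x) differentiable (at \<xi>)) \<and>
        integrable M (\<lambda>x. gradient (\<lambda>\<zeta>. f \<zeta> x) \<xi>) \<and>
        GDERIV (\<lambda>\<zeta>. \<integral>x. f \<zeta> x \<partial>M) \<xi> :> (\<integral>x. gradient (\<lambda>\<zeta>. f \<zeta> x) \<xi> \<partial>M))"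

definition nondegenerate :: "'x measure \<Rightarrow> ('x \<Rightarrow> 'a::euclidean_space) \<Rightarrow> bool" where
  "nondegenerate M h \<longleftrightarrow> (\<forall>\<xi> \<xi>'. (AE x in M. \<xi> \<bullet> h x = \<xi>' \<bullet> h x) \<longrightarrow> \<xi> = \<xi>')"

text \<open>The unnormalised density; the exponent \<open>s\<close> is \<open>- 1 / \<alpha>\<close> for the
  \<open>F\<^sup>(\<alpha>)\<close>-family and \<open>1 / \<alpha>\<close> for the \<open>F\<^sup>(-\<alpha>)\<close>-family.\<close>

definition kernel :: "real \<Rightarrow> real \<Rightarrow> ('x \<Rightarrow> 'a::euclidean_space) \<Rightarrow> 'a \<Rightarrow> 'x \<Rightarrow> real" where
  "kernel \<alpha> s h \<xi> x = (1 + \<alpha> * (\<xi> \<bullet> h x)) powr s"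

definition parameter_domain ::
  "'x measure \<Rightarrow> real \<Rightarrow> real \<Rightarrow> ('x \<Rightarrow> 'a::euclidean_space) \<Rightarrow> 'a set \<Rightarrow> bool" where
  "parameter_domain M \<alpha> s h \<Omega> \<longleftrightarrow>
     open \<Omega> \<and> convex \<Omega> \<and>
     (\<forall>\<xi>\<in>\<Omega>. \<forall>x\<in>space M. 0 < 1 + \<alpha> * (\<xi> \<bullet> h x)) \<and>
     (\<forall>\<xi>\<in>\<Omega>. integrable M (kernel \<alpha> s h \<xi>)) \<and>
     diff_under_integral M (kernel \<alpha> s h) \<Omega>"

definition potential_pos :: "'x measure \<Rightarrow> real \<Rightarrow> ('x \<Rightarrow> 'a::euclidean_space) \<Rightarrow> 'a \<Rightarrow> real" where
  "potential_pos M \<alpha> h \<xi> = - ln (\<integral>x. kernel \<alpha> (- 1 / \<alpha>) h \<xi> x \<partial>M)"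

definition density_pos :: "'x measure \<Rightarrow> real \<Rightarrow> ('x \<Rightarrow> 'a::euclidean_space) \<Rightarrow> 'a \<Rightarrow> 'x \<Rightarrow> real" where
  "density_pos M \<alpha> h \<xi> x = kernel \<alpha> (- 1 / \<alpha>) h \<xi> x * exp (potential_pos M \<alpha> h \<xi>)"

definition potential_neg :: "'x measure \<Rightarrow> real \<Rightarrow> ('x \<Rightarrow> 'a::euclidean_space) \<Rightarrow> 'a \<Rightarrow> real" where
  "potential_neg M \<alpha> h \<xi> = ln (\<integral>x. kernel \<alpha> (1 / \<alpha>) h \<xi> x \<partial>M)"

definition density_neg :: "'x measure \<Rightarrow> real \<Rightarrow> ('x \<Rightarrow> 'a::euclidean_space) \<Rightarrow> 'a \<Rightarrow> 'x \<Rightarrow> real" where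
  "density_neg M \<alpha> h \<xi> x = kernel \<alpha> (1 / \<alpha>) h \<xi> x * exp (- potential_neg M \<alpha> h \<xi>)"

definition L_div_pos :: "real \<Rightarrow> ('a::euclidean_space \<Rightarrow> real) \<Rightarrow> 'a \<Rightarrow> 'a \<Rightarrow> real" where
  "L_div_pos \<alpha> \<phi> \<xi> \<xi>' =
     1 / \<alpha> * ln (1 + \<alpha> * (gradient \<phi> \<xi>' \<bullet> (\<xi> - \<xi>'))) - (\<phi> \<xi> - \<phi> \<xi>')"

definition L_div_neg :: "real \<Rightarrow> ('a::euclidean_space \<Rightarrow> real) \<Rightarrow> 'a \<Rightarrow> 'a \<Rightarrow> real" where
  "L_div_neg \<alpha> \<phi> \<xi> \<xi>' =
     (\<phi> \<xi> - \<phi> \<xi>') - 1 / \<alpha> * ln (1 + \<alpha> * (gradient \<phi> \<xi>' \<bullet> (\<xi> - \<xi>')))"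

definition alpha_gradient :: "real \<Rightarrow> ('a::euclidean_space \<Rightarrow> real) \<Rightarrow> 'a \<Rightarrow> 'a" where
  "alpha_gradient \<alpha> \<phi> \<xi> = (1 / (1 - \<alpha> * (gradient \<phi> \<xi> \<bullet> \<xi>))) *\<^sub>R gradient \<phi> \<xi>"

text \<open>The same formula serves for the \<open>(-\<alpha>)\<close>-conjugate. The \<open>\<alpha>\<close>-gradient need
  not be injective on \<open>\<Omega>\<close> (take \<open>h\<close> constant, in dimension one), so the
  conjugate at \<open>\<eta>\<close> is the common value over all \<open>\<xi>\<close> with \<open>\<alpha>\<close>-gradient \<open>\<eta>\<close>;
  that this value is unique has to be proved in order to evaluate the definite description.\<close>

definition alpha_conjugate ::
  "real \<Rightarrow> 'a set \<Rightarrow> ('a::euclidean_space \<Rightarrow> real) \<Rightarrow> 'a \<Rightarrow> real" where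
  "alpha_conjugate \<alpha> \<Omega> \<phi> \<eta> =
     (THE t. \<exists>\<xi>\<in>\<Omega>. \<eta> = alpha_gradient \<alpha> \<phi> \<xi> \<and> t = 1 / \<alpha> * ln (1 + \<alpha> * (\<xi> \<bullet> \<eta>)) - \<phi> \<xi>)"

definition renyi_entropy :: "'x measure \<Rightarrow> real \<Rightarrow> ('x \<Rightarrow> real) \<Rightarrow> real" where
  "renyi_entropy M a p = 1 / (1 - a) * ln (\<integral>x. p x powr a \<partial>M)"

definition renyi_divergence ::
  "'x measure \<Rightarrow> real \<Rightarrow> ('x \<Rightarrow> real) \<Rightarrow> ('x \<Rightarrow> real) \<Rightarrow> real" where
  "renyi_divergence M a p q = 1 / (a - 1) * ln (\<integral>x. p x powr a * q x powr (1 - a) \<partial>M)"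

end

theory Submission
  imports Defs
begin

text \<open>Both families have densities proportional to \<open>(1 + \<alpha> \<xi>\<cdot>h)\<^sup>1\<^sup>/\<^sup>t\<close> with \<open>t = \<plusminus>\<alpha>\<close> and
  potential \<open>\<phi> = (t / \<alpha>) log Z\<close>, \<open>Z\<close> the normalising integral. Differentiating \<open>Z\<close> under the
  integral sign gives \<open>1 + \<alpha> D\<phi>(\<xi>')\<cdot>(\<xi> - \<xi>') = (Z / Z')\<^sup>t \<integral> p\<^sup>t p'\<^sup>1\<^sup>-\<^sup>t d\<mu>\<close> and
  \<open>1 - \<alpha> D\<phi>(\<xi>)\<cdot>\<xi> = Z\<^sup>-\<^sup>t \<integral> p\<^sup>1\<^sup>-\<^sup>t d\<mu>\<close>; taking logarithms yields all the formulas.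

  The \<open>\<alpha>\<close>-conjugate is well defined because, if \<open>\<xi>\<close> and \<open>\<xi>'\<close> have the same \<open>\<alpha>\<close>-gradient,
  \<open>D[\<xi> : \<xi>']\<close> is the difference of the two candidate values, so
  \<open>D[\<xi> : \<xi>'] + D[\<xi>' : \<xi>] = 0\<close>. Weighted AM-GM shows that \<open>D\<close> has a constant sign, hence
  both divergences vanish.\<close>

section \<open>Gradients, weighted AM-GM and positive integrals\<close>

lemma gradient_eqI: "GDERIV f \<xi> :> v \<Longrightarrow> gradient f \<xi> = v"
  unfolding gradient_def
  by (rule the_equality, assumption, unfold gderiv_def)
     (drule (1) has_derivative_unique, metis inner_commute vector_eq_rdot)

lemma powr_mult_powr_le:
  fixes a b t :: real
  assumes "0 < a" "0 < b" "0 \<le> t" "t \<le> 1"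
  shows "a powr t * b powr (1 - t) \<le> t * a + (1 - t) * b"
  using assms by (intro Youngs_inequality_0) auto

text \<open>Outside [0, 1], with \<open>c = a powr t * b powr (1 - t)\<close>, one of
  \<open>a\<close>, \<open>b\<close> is a weighted geometric mean of \<open>c\<close> and the other:
  \<open>a\<close> with weight 1/t on \<open>c\<close> if 1 \<le> t, \<open>b\<close> with weight
  1/(1 - t) if t \<le> 0. The ordinary inequality for that mean, multiplied by t or 1 - t, gives the
  reversed one.\<close>

lemma powr_mult_powr_ge:
  fixes a b t :: real
  assumes "0 < a" "0 < b" "t \<le> 0 \<or> 1 \<le> t"
  shows "t * a + (1 - t) * b \<le> a powr t * b powr (1 - t)"
proof -
  define c where "c = a powr t * b powr (1 - t)"
  have c: "0 < c" using assms by (simp add: c_def)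
  show ?thesis
  proof (cases "1 \<le> t")
    case True
    have "c powr (1 / t) * b powr (1 - 1 / t) \<le> 1 / t * c + (1 - 1 / t) * b"
      using True c assms by (intro powr_mult_powr_le) auto
    moreover have "c powr (1 / t) * b powr (1 - 1 / t) = a"
    proof -
      have "t * (1 / t) = 1" "(1 - t) * (1 / t) + (1 - 1 / t) = 0"
        using True by (auto simp: field_simps)
      then show ?thesis
        using assms by (simp add: c_def powr_mult powr_powr mult.assoc flip: powr_add)
    qed
    ultimately have "t * a \<le> t * (1 / t * c + (1 - 1 / t) * b)"
      using True by (intro mult_left_mono) auto
    also have "\<dots> = c + (t - 1) * b" using True by (simp add: field_simps)
    finally show ?thesis by (simp add: c_def algebra_simps)
  next
    case False
    then have t: "t \<le> 0" using assms by auto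
    define w where "w = 1 / (1 - t)"
    have w: "(1 - t) * w = 1" "t * w + (1 - w) = 0" "0 \<le> w" "w \<le> 1"
      using t by (auto simp: w_def field_simps)
    have "c powr w * a powr (1 - w) \<le> w * c + (1 - w) * a"
      using w c assms by (intro powr_mult_powr_le) auto
    moreover have "c powr w * a powr (1 - w) = b"
    proof -
      have "c powr w * a powr (1 - w) = (a powr (t * w) * a powr (1 - w)) * b powr ((1 - t) * w)"
        using assms by (simp add: c_def powr_mult powr_powr)
      also have "a powr (t * w) * a powr (1 - w) = a powr (t * w + (1 - w))"
        by (simp only: powr_add)
      finally show ?thesis using assms w by simp
    qed
    ultimately have "(1 - t) * b \<le> (1 - t) * (w * c + (1 - w) * a)"
      using t by (intro mult_left_mono) auto
    also have "\<dots> = ((1 - t) * w) * c + ((1 - t) - (1 - t) * w) * a" by (simp add: algebra_simps)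
    also have "\<dots> = c - t * a" using w by simp
    finally show ?thesis by (simp add: c_def algebra_simps)
  qed
qed

text \<open>Strictness survives integration because the whole space has measure 1 and so is not
  null.\<close>

lemma (in prob_space) integral_pos:
  fixes f :: "'a \<Rightarrow> real"
  assumes "integrable M f" "\<And>x. x \<in> space M \<Longrightarrow> 0 < f x"
  shows "0 < (\<integral>x. f x \<partial>M)"
  using integral_less_AE_space[of "\<lambda>_. 0" f] assms emeasure_space_1 by simp

lemma GDERIV_kernel:
  assumes "0 < 1 + \<alpha> * (\<xi> \<bullet> h x)"
  shows "GDERIV (\<lambda>\<zeta>. kernel \<alpha> s h \<zeta> x) \<xi> :> (s * \<alpha> * (1 + \<alpha> * (\<xi> \<bullet> h x)) powr (s - 1)) *\<^sub>R h x"
proof -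
  have "GDERIV (\<lambda>\<zeta>. 1 + \<alpha> * (\<zeta> \<bullet> h x)) \<xi> :> \<alpha> *\<^sub>R h x"
    unfolding gderiv_def by (auto intro!: derivative_eq_intros)
  from GDERIV_DERIV_compose[OF this has_real_derivative_powr[OF assms, of s]]
  show ?thesis unfolding kernel_def by (simp add: mult_ac)
qed

section \<open>Both families under one parameter t\<close>

text \<open>t = -\<alpha> gives the F^(\<alpha>)-family and t = \<alpha> the
  F^(-\<alpha>)-family.\<close>

locale deformed_exponential_family = prob_space M
  for M :: "'x measure" and h :: "'x \<Rightarrow> 'a::euclidean_space" and \<Omega> :: "'a set"
    and \<alpha> t :: real +
  assumes alpha_pos: "0 < \<alpha>"
    and t_cases: "t = \<alpha> \<or> t = - \<alpha>"
    and domain: "parameter_domain M \<alpha> (1 / t) h \<Omega>"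
begin

definition base :: "'a \<Rightarrow> 'x \<Rightarrow> real" where
  "base \<xi> x = 1 + \<alpha> * (\<xi> \<bullet> h x)"

definition Z :: "'a \<Rightarrow> real" where
  "Z \<xi> = (\<integral>x. kernel \<alpha> (1 / t) h \<xi> x \<partial>M)"

text \<open>The factor t/\<alpha> is the sign that tells \<open>potential_pos\<close> (-1) from
  \<open>potential_neg\<close> (+1).\<close>

definition potential :: "'a \<Rightarrow> real" where
  "potential \<xi> = t / \<alpha> * ln (Z \<xi>)"

definition pdf :: "'a \<Rightarrow> 'x \<Rightarrow> real" where
  "pdf \<xi> x = kernel \<alpha> (1 / t) h \<xi> x / Z \<xi>"

lemma t_nonzero: "t \<noteq> 0"
  using alpha_pos t_cases by auto

lemma base_pos: "\<xi> \<in> \<Omega> \<Longrightarrow> x \<in> space M \<Longrightarrow> 0 < base \<xi> x"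
  using domain by (auto simp: parameter_domain_def base_def)

lemma kernel_eq: "kernel \<alpha> s h \<xi> x = base \<xi> x powr s"
  by (simp add: kernel_def base_def)

lemma integrable_kernel: "\<xi> \<in> \<Omega> \<Longrightarrow> integrable M (\<lambda>x. base \<xi> x powr (1 / t))"
  using domain by (auto simp: parameter_domain_def kernel_eq[abs_def])

lemma Z_pos: "\<xi> \<in> \<Omega> \<Longrightarrow> 0 < Z \<xi>"
  unfolding Z_def kernel_eq
  by (intro integral_pos integrable_kernel) (use base_pos in force)+

lemma pdf_pos: "\<xi> \<in> \<Omega> \<Longrightarrow> x \<in> space M \<Longrightarrow> 0 < pdf \<xi> x"
  using Z_pos base_pos[of \<xi> x] by (simp add: pdf_def kernel_eq)

lemma integrable_pdf: "\<xi> \<in> \<Omega> \<Longrightarrow> integrable M (pdf \<xi>)"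
  unfolding pdf_def[abs_def] kernel_eq by (simp add: integrable_kernel)

lemma integral_pdf: "\<xi> \<in> \<Omega> \<Longrightarrow> (\<integral>x. pdf \<xi> x \<partial>M) = 1"
  using Z_pos[of \<xi>] by (simp add: pdf_def Z_def)

section \<open>Differentiation under the integral sign\<close>

lemma gradient_kernel:
  assumes "\<xi> \<in> \<Omega>" "x \<in> space M"
  shows "gradient (\<lambda>\<zeta>. kernel \<alpha> (1 / t) h \<zeta> x) \<xi> = (\<alpha> / t) *\<^sub>R (base \<xi> x powr (1 / t - 1) *\<^sub>R h x)"
  using gradient_eqI[OF GDERIV_kernel, of \<alpha> \<xi> h x "1 / t"] base_pos[OF assms]
  by (simp add: base_def)

text \<open>Up to the factor \<alpha>/t the integrand is the gradient of the kernel, whose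
  integrability is part of \<open>diff_under_integral\<close>.\<close>

lemma integrable_weighted: "\<xi> \<in> \<Omega> \<Longrightarrow> integrable M (\<lambda>x. base \<xi> x powr (1 / t - 1) *\<^sub>R h x)"
proof -
  assume \<xi>: "\<xi> \<in> \<Omega>"
  have "integrable M (\<lambda>x. gradient (\<lambda>\<zeta>. kernel \<alpha> (1 / t) h \<zeta> x) \<xi>)"
    using domain \<xi> by (auto simp: parameter_domain_def diff_under_integral_def)
  then have "integrable M (\<lambda>x. (\<alpha> / t) *\<^sub>R (base \<xi> x powr (1 / t - 1) *\<^sub>R h x))"
    by (rule Bochner_Integration.integrable_cong[THEN iffD1, rotated -1])
       (simp_all add: gradient_kernel \<xi>)
  from integrable_scaleR_right[OF this, of "t / \<alpha>"] show ?thesis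
    using t_nonzero alpha_pos by simp
qed

text \<open>In the chain rule the \<alpha>/t from the kernel cancels the t/\<alpha> of the
  potential, so both families share one formula.\<close>

lemma gradient_potential:
  assumes \<xi>: "\<xi> \<in> \<Omega>"
  shows "gradient potential \<xi> = (1 / Z \<xi>) *\<^sub>R (\<integral>x. base \<xi> x powr (1 / t - 1) *\<^sub>R h x \<partial>M)"
proof -
  have "(\<integral>x. gradient (\<lambda>\<zeta>. kernel \<alpha> (1 / t) h \<zeta> x) \<xi> \<partial>M)
      = (\<integral>x. (\<alpha> / t) *\<^sub>R (base \<xi> x powr (1 / t - 1) *\<^sub>R h x) \<partial>M)"
    by (intro Bochner_Integration.integral_cong) (simp_all add: gradient_kernel \<xi>)
  also have "\<dots> = (\<alpha> / t) *\<^sub>R (\<integral>x. base \<xi> x powr (1 / t - 1) *\<^sub>R h x \<partial>M)"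
    by (rule integral_scaleR_right)
  finally have "GDERIV Z \<xi> :> (\<alpha> / t) *\<^sub>R (\<integral>x. base \<xi> x powr (1 / t - 1) *\<^sub>R h x \<partial>M)"
    using domain \<xi> unfolding Z_def[abs_def]
    by (auto simp: parameter_domain_def diff_under_integral_def)
  moreover have "((\<lambda>z. t / \<alpha> * ln z) has_real_derivative t / \<alpha> * (1 / Z \<xi>)) (at (Z \<xi>))"
    using Z_pos[OF \<xi>] alpha_pos by (auto intro!: derivative_eq_intros)
  ultimately have "GDERIV potential \<xi> :>
      (t / \<alpha> * (1 / Z \<xi>)) *\<^sub>R ((\<alpha> / t) *\<^sub>R (\<integral>x. base \<xi> x powr (1 / t - 1) *\<^sub>R h x \<partial>M))"
    unfolding potential_def[abs_def] by (rule GDERIV_DERIV_compose)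
  then show ?thesis
    using t_nonzero alpha_pos by (intro gradient_eqI) simp
qed

text \<open>The inner product with a fixed vector passes through the Bochner integral; this reduces
  the later computations to scalar integrals.\<close>

lemma
  assumes \<xi>: "\<xi> \<in> \<Omega>"
  shows integrable_inner: "integrable M (\<lambda>x. base \<xi> x powr (1 / t - 1) * (v \<bullet> h x))"
    and inner_gradient_potential:
      "gradient potential \<xi> \<bullet> v = (1 / Z \<xi>) * (\<integral>x. base \<xi> x powr (1 / t - 1) * (v \<bullet> h x) \<partial>M)"
  using integrable_inner_right[of v, OF integrable_weighted[OF \<xi>]]
    integral_inner_right[of v, OF integrable_weighted[OF \<xi>]]
  by (simp_all add: gradient_potential[OF \<xi>] inner_commute)

section \<open>Integrals of powers of densities\<close>

lemma powr_base_split: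
  assumes "\<xi> \<in> \<Omega>" "x \<in> space M"
  shows "base \<xi> x powr (1 / t) = base \<xi> x powr (1 / t - 1) * base \<xi> x"
  using base_pos[OF assms] by (simp add: powr_diff)

text \<open>Since 1 = \<open>base \<xi> x - \<alpha> * (\<xi> \<bullet> h x)\<close>, this power is
  the kernel minus a multiple of an integrand from \<open>integrable_inner\<close>.\<close>

lemma integrable_powr_base:
  assumes \<xi>: "\<xi> \<in> \<Omega>"
  shows "integrable M (\<lambda>x. base \<xi> x powr (1 / t - 1))"
proof -
  have "integrable M (\<lambda>x. base \<xi> x powr (1 / t) - \<alpha> * (base \<xi> x powr (1 / t - 1) * (\<xi> \<bullet> h x)))"
    using integrable_kernel[OF \<xi>] integrable_inner[OF \<xi>] by simp
  then show ?thesis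
    by (rule Bochner_Integration.integrable_cong[THEN iffD1, rotated -1])
       (simp_all add: powr_base_split[OF \<xi>], simp add: base_def algebra_simps)
qed

text \<open>The t-th power of a density is affine in \<xi> up to normalisation, and its (1 - t)-th
  power is the weight in the gradient of the potential. This match links Renyi integrals to
  gradients.\<close>

lemma pdf_powr:
  assumes "\<xi> \<in> \<Omega>" "x \<in> space M"
  shows "pdf \<xi> x powr t = base \<xi> x / Z \<xi> powr t"
    and "pdf \<xi> x powr (1 - t) = base \<xi> x powr (1 / t - 1) * Z \<xi> powr t / Z \<xi>"
proof -
  have "1 / t * (1 - t) = 1 / t - 1" using t_nonzero by (simp add: field_simps)
  then show "pdf \<xi> x powr t = base \<xi> x / Z \<xi> powr t"
    "pdf \<xi> x powr (1 - t) = base \<xi> x powr (1 / t - 1) * Z \<xi> powr t / Z \<xi>"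
    using Z_pos[OF assms(1)] base_pos[OF assms] t_nonzero
    by (simp_all add: pdf_def kernel_eq powr_divide powr_powr powr_diff[of "Z \<xi>"])
qed

text \<open>The integral in the Renyi divergence of order 1 - t from \<open>pdf \<xi>'\<close> to
  \<open>pdf \<xi>\<close>, and equally in that of order t in the opposite direction.\<close>

definition overlap :: "'a \<Rightarrow> 'a \<Rightarrow> real" where
  "overlap \<xi> \<xi>' = (\<integral>x. pdf \<xi> x powr t * pdf \<xi>' x powr (1 - t) \<partial>M)"

definition moment :: "'a \<Rightarrow> real" where
  "moment \<xi> = (\<integral>x. pdf \<xi> x powr (1 - t) \<partial>M)"

text \<open>By affinity, \<open>base \<xi> x\<close> is \<open>base \<xi>' x\<close> plus
  \<open>\<alpha> * ((\<xi> - \<xi>') \<bullet> h x)\<close>. Against the weight at \<xi>', the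
  first term integrates to \<open>Z \<xi>'\<close> and the second to a multiple of a directional
  derivative of the potential.\<close>

lemma
  assumes \<xi>: "\<xi> \<in> \<Omega>" and \<xi>': "\<xi>' \<in> \<Omega>"
  shows integrable_overlap: "integrable M (\<lambda>x. pdf \<xi> x powr t * pdf \<xi>' x powr (1 - t))"
    and overlap_eq: "overlap \<xi> \<xi>' =
      (Z \<xi>' / Z \<xi>) powr t * (1 + \<alpha> * (gradient potential \<xi>' \<bullet> (\<xi> - \<xi>')))"
proof -
  let ?w = "\<lambda>x. base \<xi>' x powr (1 / t - 1)"
  let ?f = "\<lambda>x. (Z \<xi>' / Z \<xi>) powr t / Z \<xi>' *
    (base \<xi>' x powr (1 / t) + \<alpha> * (?w x * ((\<xi> - \<xi>') \<bullet> h x)))"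
  have eq: "pdf \<xi> x powr t * pdf \<xi>' x powr (1 - t) = ?f x" if x: "x \<in> space M" for x
  proof -
    have "base \<xi>' x powr (1 / t) + \<alpha> * (?w x * ((\<xi> - \<xi>') \<bullet> h x)) = ?w x * base \<xi> x"
      unfolding powr_base_split[OF \<xi>' x] by (simp add: base_def inner_diff_left algebra_simps)
    then show ?thesis
      using Z_pos[OF \<xi>] Z_pos[OF \<xi>'] by (simp add: pdf_powr \<xi> \<xi>' x powr_divide)
  qed
  have f: "integrable M ?f"
    using integrable_kernel[OF \<xi>'] integrable_inner[OF \<xi>'] by simp
  then show "integrable M (\<lambda>x. pdf \<xi> x powr t * pdf \<xi>' x powr (1 - t))"
    by (rule Bochner_Integration.integrable_cong[THEN iffD1, rotated -1]) (simp_all add: eq)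
  have "overlap \<xi> \<xi>' = (\<integral>x. ?f x \<partial>M)"
    unfolding overlap_def by (intro Bochner_Integration.integral_cong) (simp_all add: eq)
  also have "\<dots> = (Z \<xi>' / Z \<xi>) powr t / Z \<xi>' *
      (Z \<xi>' + \<alpha> * (\<integral>x. ?w x * ((\<xi> - \<xi>') \<bullet> h x) \<partial>M))"
    using integrable_kernel[OF \<xi>'] integrable_inner[OF \<xi>'] by (simp add: Z_def kernel_eq)
  also have "\<dots> = (Z \<xi>' / Z \<xi>) powr t * (1 + \<alpha> * (gradient potential \<xi>' \<bullet> (\<xi> - \<xi>')))"
    using Z_pos[OF \<xi>'] by (simp add: inner_gradient_potential[OF \<xi>'] field_simps)
  finally show "overlap \<xi> \<xi>' =
      (Z \<xi>' / Z \<xi>) powr t * (1 + \<alpha> * (gradient potential \<xi>' \<bullet> (\<xi> - \<xi>')))" .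
qed

text \<open>The computation of \<open>overlap_eq\<close> with \<open>base \<xi> x\<close> replaced
  by its value 1 at the origin. As the origin may lie outside \<Omega>, it is done
  separately.\<close>

lemma moment_eq:
  assumes \<xi>: "\<xi> \<in> \<Omega>"
  shows "moment \<xi> = Z \<xi> powr t * (1 - \<alpha> * (gradient potential \<xi> \<bullet> \<xi>))"
proof -
  let ?w = "\<lambda>x. base \<xi> x powr (1 / t - 1)"
  have "moment \<xi> = (\<integral>x. Z \<xi> powr t / Z \<xi> *
      (base \<xi> x powr (1 / t) - \<alpha> * (?w x * (\<xi> \<bullet> h x))) \<partial>M)"
    unfolding moment_def
  proof (intro Bochner_Integration.integral_cong refl)
    fix x assume x: "x \<in> space M"
    have "base \<xi> x powr (1 / t) - \<alpha> * (?w x * (\<xi> \<bullet> h x)) = ?w x"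
      unfolding powr_base_split[OF \<xi> x] by (simp add: base_def algebra_simps)
    then show "pdf \<xi> x powr (1 - t) = Z \<xi> powr t / Z \<xi> *
      (base \<xi> x powr (1 / t) - \<alpha> * (?w x * (\<xi> \<bullet> h x)))"
      by (simp add: pdf_powr \<xi> x)
  qed
  also have "\<dots> = Z \<xi> powr t / Z \<xi> * (Z \<xi> - \<alpha> * (\<integral>x. ?w x * (\<xi> \<bullet> h x) \<partial>M))"
    using integrable_kernel[OF \<xi>] integrable_inner[OF \<xi>] by (simp add: Z_def kernel_eq)
  also have "\<dots> = Z \<xi> powr t * (1 - \<alpha> * (gradient potential \<xi> \<bullet> \<xi>))"
    using Z_pos[OF \<xi>] by (simp add: inner_gradient_potential[OF \<xi>] field_simps)
  finally show ?thesis .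
qed

lemma overlap_pos: "\<xi> \<in> \<Omega> \<Longrightarrow> \<xi>' \<in> \<Omega> \<Longrightarrow> 0 < overlap \<xi> \<xi>'"
  unfolding overlap_def
  by (intro integral_pos integrable_overlap) (use pdf_pos in \<open>force intro!: mult_pos_pos\<close>)+

lemma moment_pos:
  assumes \<xi>: "\<xi> \<in> \<Omega>"
  shows "0 < moment \<xi>"
  unfolding moment_def
proof (rule integral_pos)
  have "integrable M (\<lambda>x. base \<xi> x powr (1 / t - 1) * Z \<xi> powr t / Z \<xi>)"
    using integrable_powr_base[OF \<xi>] by simp
  then show "integrable M (\<lambda>x. pdf \<xi> x powr (1 - t))"
    by (rule Bochner_Integration.integrable_cong[THEN iffD1, rotated -1])
       (simp_all add: pdf_powr \<xi>)
qed (use pdf_pos[OF \<xi>] in force)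

section \<open>Divergence and conjugate as logarithms\<close>

lemma L_div_pos_potential:
  assumes "\<xi> \<in> \<Omega>" "\<xi>' \<in> \<Omega>"
  shows "L_div_pos \<alpha> potential \<xi> \<xi>' = 1 / \<alpha> * ln (overlap \<xi> \<xi>')"
proof -
  let ?c = "1 + \<alpha> * (gradient potential \<xi>' \<bullet> (\<xi> - \<xi>'))"
  have "0 < Z \<xi>" "0 < Z \<xi>'" using Z_pos assms by auto
  then have "0 < (Z \<xi>' / Z \<xi>) powr t" by simp
  \<comment> \<open>Positivity is inherited from \<open>overlap\<close>, which is a positive
    multiple of \<open>?c\<close>; it is what allows the logarithm of the product to be
    split.\<close>
  moreover have "0 < ?c"
    using overlap_pos[OF assms] calculation by (simp add: overlap_eq[OF assms] zero_less_mult_iff)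
  ultimately have "ln (overlap \<xi> \<xi>') = t * (ln (Z \<xi>') - ln (Z \<xi>)) + ln ?c"
    using \<open>0 < Z \<xi>\<close> \<open>0 < Z \<xi>'\<close> by (simp add: overlap_eq[OF assms] ln_mult ln_powr ln_div)
  then show ?thesis
    using alpha_pos by (simp add: L_div_pos_def potential_def field_simps)
qed

lemma L_div_neg_potential:
  assumes "\<xi> \<in> \<Omega>" "\<xi>' \<in> \<Omega>"
  shows "L_div_neg \<alpha> potential \<xi> \<xi>' = - (1 / \<alpha> * ln (overlap \<xi> \<xi>'))"
  using L_div_pos_potential[OF assms] by (simp add: L_div_neg_def L_div_pos_def)

lemma gradient_gap_pos: "\<xi> \<in> \<Omega> \<Longrightarrow> 0 < 1 - \<alpha> * (gradient potential \<xi> \<bullet> \<xi>)"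
  using moment_pos[of \<xi>] moment_eq[of \<xi>] Z_pos[of \<xi>] by (simp add: zero_less_mult_iff)

text \<open>For \<xi> = \<xi>' the numerator is 1, which is the case behind the conjugate; distinct
  points bring in the divergence.\<close>

lemma one_plus_alpha_gradient:
  assumes "\<xi>' \<in> \<Omega>"
  shows "1 + \<alpha> * (\<xi> \<bullet> alpha_gradient \<alpha> potential \<xi>') =
    (1 + \<alpha> * (gradient potential \<xi>' \<bullet> (\<xi> - \<xi>'))) / (1 - \<alpha> * (gradient potential \<xi>' \<bullet> \<xi>'))"
  using gradient_gap_pos[OF assms]
  by (simp add: alpha_gradient_def inner_diff_right inner_commute[of \<xi>] field_simps)

definition conjugate_value :: "'a \<Rightarrow> real" where
  "conjugate_value \<xi> = 1 / \<alpha> * ln (1 + \<alpha> * (\<xi> \<bullet> alpha_gradient \<alpha> potential \<xi>)) - potential \<xi>"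

text \<open>The logarithm is that of \<open>Z \<xi> powr t / moment \<xi>\<close>, and the power of
  \<open>Z\<close> contributes exactly the potential that is subtracted.\<close>

lemma conjugate_value_eq:
  assumes \<xi>: "\<xi> \<in> \<Omega>"
  shows "conjugate_value \<xi> = - (1 / \<alpha>) * ln (moment \<xi>)"
proof -
  have "ln (moment \<xi>) = t * ln (Z \<xi>) + ln (1 - \<alpha> * (gradient potential \<xi> \<bullet> \<xi>))"
    using gradient_gap_pos[OF \<xi>] Z_pos[OF \<xi>] by (simp add: moment_eq[OF \<xi>] ln_mult ln_powr)
  then show ?thesis
    using gradient_gap_pos[OF \<xi>] alpha_pos
    by (simp add: conjugate_value_def one_plus_alpha_gradient[OF \<xi>] ln_div potential_def field_simps)
qed

text \<open>With \<eta> shared, both logarithms have arguments over the same denominator, by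
  \<open>one_plus_alpha_gradient\<close> at \<xi>'. It cancels in the difference, leaving the
  logarithm of the divergence.\<close>

lemma L_div_pos_eq_conjugate_diff:
  assumes \<xi>: "\<xi> \<in> \<Omega>" and \<xi>': "\<xi>' \<in> \<Omega>"
    and eq: "alpha_gradient \<alpha> potential \<xi> = alpha_gradient \<alpha> potential \<xi>'"
  shows "L_div_pos \<alpha> potential \<xi> \<xi>' = conjugate_value \<xi> - conjugate_value \<xi>'"
proof -
  have "0 < 1 + \<alpha> * (gradient potential \<xi>' \<bullet> (\<xi> - \<xi>'))"
    using overlap_pos[OF \<xi> \<xi>'] Z_pos[OF \<xi>] Z_pos[OF \<xi>']
    by (simp add: overlap_eq[OF \<xi> \<xi>'] zero_less_mult_iff)
  then show ?thesis
    using gradient_gap_pos[OF \<xi>'] alpha_pos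
    by (simp add: conjugate_value_def eq one_plus_alpha_gradient[OF \<xi>'] ln_div L_div_pos_def
        field_simps)
qed

section \<open>Uniqueness of the conjugate value\<close>

text \<open>Integrated AM-GM: densities integrate to 1 and the weights t, 1 - t sum to 1, so the
  arithmetic mean has integral 1.\<close>

lemma overlap_le_1:
  assumes "0 \<le> t" "t \<le> 1" "\<xi> \<in> \<Omega>" "\<xi>' \<in> \<Omega>"
  shows "overlap \<xi> \<xi>' \<le> 1"
proof -
  have "overlap \<xi> \<xi>' \<le> (\<integral>x. t * pdf \<xi> x + (1 - t) * pdf \<xi>' x \<partial>M)"
    unfolding overlap_def using assms
    by (intro integral_mono integrable_overlap powr_mult_powr_le pdf_pos)
       (simp_all add: integrable_pdf)
  also have "\<dots> = 1" using assms by (simp add: integrable_pdf integral_pdf)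
  finally show ?thesis .
qed

lemma overlap_ge_1:
  assumes "t \<le> 0 \<or> 1 \<le> t" "\<xi> \<in> \<Omega>" "\<xi>' \<in> \<Omega>"
  shows "1 \<le> overlap \<xi> \<xi>'"
proof -
  have "1 = (\<integral>x. t * pdf \<xi> x + (1 - t) * pdf \<xi>' x \<partial>M)"
    using assms by (simp add: integrable_pdf integral_pdf)
  also have "\<dots> \<le> overlap \<xi> \<xi>'"
    unfolding overlap_def using assms
    by (intro integral_mono integrable_overlap powr_mult_powr_ge pdf_pos)
       (simp_all add: integrable_pdf)
  finally show ?thesis .
qed

lemma conjugate_value_unique:
  assumes \<xi>: "\<xi> \<in> \<Omega>" and \<xi>': "\<xi>' \<in> \<Omega>"
    and eq: "alpha_gradient \<alpha> potential \<xi> = alpha_gradient \<alpha> potential \<xi>'"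
  shows "conjugate_value \<xi> = conjugate_value \<xi>'"
proof -
  have 1: "conjugate_value \<xi> - conjugate_value \<xi>' = 1 / \<alpha> * ln (overlap \<xi> \<xi>')"
    using L_div_pos_eq_conjugate_diff[OF \<xi> \<xi>' eq] L_div_pos_potential[OF \<xi> \<xi>'] by simp
  have 2: "conjugate_value \<xi>' - conjugate_value \<xi> = 1 / \<alpha> * ln (overlap \<xi>' \<xi>)"
    using L_div_pos_eq_conjugate_diff[OF \<xi>' \<xi> eq[symmetric]] L_div_pos_potential[OF \<xi>' \<xi>] by simp
  show ?thesis
  \<comment> \<open>The split follows the two forms of AM-GM: within [0, 1] both overlaps are at
    most 1, outside it both are at least 1.\<close>
  proof (cases "0 \<le> t \<and> t \<le> 1")
    case True
    then have "ln (overlap \<xi> \<xi>') \<le> 0" "ln (overlap \<xi>' \<xi>) \<le> 0"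
      using \<xi> \<xi>' by (simp_all add: overlap_le_1 overlap_pos)
    then have "1 / \<alpha> * ln (overlap \<xi> \<xi>') \<le> 0" "1 / \<alpha> * ln (overlap \<xi>' \<xi>) \<le> 0"
      using alpha_pos by (simp_all add: divide_nonpos_pos)
    then show ?thesis using 1 2 by linarith
  next
    case False
    then have "0 \<le> ln (overlap \<xi> \<xi>')" "0 \<le> ln (overlap \<xi>' \<xi>)"
      using \<xi> \<xi>' overlap_ge_1 by (auto intro!: ln_ge_zero)
    then have "0 \<le> 1 / \<alpha> * ln (overlap \<xi> \<xi>')" "0 \<le> 1 / \<alpha> * ln (overlap \<xi>' \<xi>)"
      using alpha_pos by simp_all
    then show ?thesis using 1 2 by linarith
  qed
qed

text \<open>In the definite description \<xi> itself witnesses existence, and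
  \<open>conjugate_value_unique\<close> excludes any other value.\<close>

lemma alpha_conjugate_potential:
  assumes \<xi>: "\<xi> \<in> \<Omega>"
  shows "alpha_conjugate \<alpha> \<Omega> potential (alpha_gradient \<alpha> potential \<xi>) =
    - (1 / \<alpha>) * ln (moment \<xi>)"
  unfolding alpha_conjugate_def
proof (rule the_equality)
  show "\<exists>\<zeta>\<in>\<Omega>. alpha_gradient \<alpha> potential \<xi> = alpha_gradient \<alpha> potential \<zeta> \<and>
      - (1 / \<alpha>) * ln (moment \<xi>) =
        1 / \<alpha> * ln (1 + \<alpha> * (\<zeta> \<bullet> alpha_gradient \<alpha> potential \<xi>)) - potential \<zeta>"
    using \<xi> conjugate_value_eq[OF \<xi>] by (auto simp: conjugate_value_def)
next
  fix r
  assume "\<exists>\<zeta>\<in>\<Omega>. alpha_gradient \<alpha> potential \<xi> = alpha_gradient \<alpha> potential \<zeta> \<and>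
      r = 1 / \<alpha> * ln (1 + \<alpha> * (\<zeta> \<bullet> alpha_gradient \<alpha> potential \<xi>)) - potential \<zeta>"
  then obtain \<zeta> where "\<zeta> \<in> \<Omega>" "alpha_gradient \<alpha> potential \<xi> = alpha_gradient \<alpha> potential \<zeta>"
      "r = conjugate_value \<zeta>"
    by (auto simp: conjugate_value_def)
  then show "r = - (1 / \<alpha>) * ln (moment \<xi>)"
    using conjugate_value_unique[OF \<xi>] conjugate_value_eq[OF \<xi>] by metis
qed

end

section \<open>Specialisation to t = -\<alpha> and t = \<alpha>\<close>

theorem theorem13:
  fixes \<mu> :: "'x measure"
    and h :: "'x \<Rightarrow> real ^ 'd"
    and \<Omega> :: "(real ^ 'd) set"
    and \<alpha> :: real
  assumes "prob_space \<mu>"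
    and "h \<in> borel_measurable \<mu>"
    and "\<forall>x\<in>space \<mu>. \<forall>i. 0 < h x $ i"
    and "nondegenerate \<mu> h"
    and "0 < \<alpha>"
  shows
    "(parameter_domain \<mu> \<alpha> (- 1 / \<alpha>) h \<Omega> \<longrightarrow>
       (let \<phi> = potential_pos \<mu> \<alpha> h; p = density_pos \<mu> \<alpha> h; \<psi> = alpha_conjugate \<alpha> \<Omega> \<phi> in
          (\<forall>\<xi>\<in>\<Omega>. \<forall>\<xi>'\<in>\<Omega>. L_div_pos \<alpha> \<phi> \<xi> \<xi>' = renyi_divergence \<mu> (1 + \<alpha>) (p \<xi>') (p \<xi>)) \<and>
          (\<forall>\<xi>\<in>\<Omega>. \<psi> (alpha_gradient \<alpha> \<phi> \<xi>) = renyi_entropy \<mu> (1 + \<alpha>) (p \<xi>)))) \<and>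
     (parameter_domain \<mu> \<alpha> (1 / \<alpha>) h \<Omega> \<longrightarrow>
       (let \<phi> = potential_neg \<mu> \<alpha> h; p = density_neg \<mu> \<alpha> h; \<psi> = alpha_conjugate \<alpha> \<Omega> \<phi> in
          (\<alpha> < 1 \<longrightarrow>
            (\<forall>\<xi>\<in>\<Omega>. \<forall>\<xi>'\<in>\<Omega>. L_div_neg \<alpha> \<phi> \<xi> \<xi>' = renyi_divergence \<mu> (1 - \<alpha>) (p \<xi>') (p \<xi>)) \<and>
            (\<forall>\<xi>\<in>\<Omega>. \<psi> (alpha_gradient \<alpha> \<phi> \<xi>) = - renyi_entropy \<mu> (1 - \<alpha>) (p \<xi>))) \<and>
          (1 < \<alpha> \<longrightarrow>
            (\<forall>\<xi>\<in>\<Omega>. \<forall>\<xi>'\<in>\<Omega>. L_div_pos \<alpha> \<phi> \<xi> \<xi>' =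
               (\<alpha> - 1) / \<alpha> * renyi_divergence \<mu> \<alpha> (p \<xi>) (p \<xi>')) \<and>
            (\<forall>\<xi>\<in>\<Omega>. \<psi> (alpha_gradient \<alpha> \<phi> \<xi>) =
               - (1 / \<alpha>) * ln (\<integral>x. p \<xi> x powr (1 - \<alpha>) \<partial>\<mu>)))))"
proof -
  have pos: "L_div_pos \<alpha> \<phi> \<xi> \<xi>' = renyi_divergence \<mu> (1 + \<alpha>) (p \<xi>') (p \<xi>)"
      "alpha_conjugate \<alpha> \<Omega> \<phi> (alpha_gradient \<alpha> \<phi> \<xi>) = renyi_entropy \<mu> (1 + \<alpha>) (p \<xi>)"
    if "parameter_domain \<mu> \<alpha> (- 1 / \<alpha>) h \<Omega>" "\<xi> \<in> \<Omega>" "\<xi>' \<in> \<Omega>"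
      and \<phi>: "\<phi> = potential_pos \<mu> \<alpha> h" and p: "p = density_pos \<mu> \<alpha> h" for \<xi> \<xi>' \<phi> p
  proof -
    interpret deformed_exponential_family \<mu> h \<Omega> \<alpha> "- \<alpha>"
      using assms that by (intro deformed_exponential_family.intro
          deformed_exponential_family_axioms.intro) auto
    have \<phi>: "\<phi> = potential"
      using alpha_pos by (auto simp: \<phi> potential_def potential_pos_def Z_def)
    have p: "p \<zeta> = pdf \<zeta>" if "\<zeta> \<in> \<Omega>" for \<zeta>
      using Z_pos[OF that]
      by (auto simp: p pdf_def density_pos_def potential_pos_def Z_def exp_minus divide_inverse)
    show "L_div_pos \<alpha> \<phi> \<xi> \<xi>' = renyi_divergence \<mu> (1 + \<alpha>) (p \<xi>') (p \<xi>)"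
      using L_div_pos_potential[OF that(2,3)]
      by (simp add: \<phi> p that(2,3) renyi_divergence_def overlap_def mult.commute)
    show "alpha_conjugate \<alpha> \<Omega> \<phi> (alpha_gradient \<alpha> \<phi> \<xi>) = renyi_entropy \<mu> (1 + \<alpha>) (p \<xi>)"
      using alpha_conjugate_potential[OF that(2)]
      by (simp add: \<phi> p that(2,3) renyi_entropy_def moment_def)
  qed
  have neg: "L_div_neg \<alpha> \<phi> \<xi> \<xi>' = renyi_divergence \<mu> (1 - \<alpha>) (p \<xi>') (p \<xi>)"
      "1 < \<alpha> \<Longrightarrow> L_div_pos \<alpha> \<phi> \<xi> \<xi>' = (\<alpha> - 1) / \<alpha> * renyi_divergence \<mu> \<alpha> (p \<xi>) (p \<xi>')"
      "alpha_conjugate \<alpha> \<Omega> \<phi> (alpha_gradient \<alpha> \<phi> \<xi>) =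
        - (1 / \<alpha>) * ln (\<integral>x. p \<xi> x powr (1 - \<alpha>) \<partial>\<mu>)"
    if "parameter_domain \<mu> \<alpha> (1 / \<alpha>) h \<Omega>" "\<xi> \<in> \<Omega>" "\<xi>' \<in> \<Omega>"
      and \<phi>: "\<phi> = potential_neg \<mu> \<alpha> h" and p: "p = density_neg \<mu> \<alpha> h" for \<xi> \<xi>' \<phi> p
  proof -
    interpret deformed_exponential_family \<mu> h \<Omega> \<alpha> \<alpha>
      using assms that by (intro deformed_exponential_family.intro
          deformed_exponential_family_axioms.intro) auto
    have \<phi>: "\<phi> = potential"
      using alpha_pos by (auto simp: \<phi> potential_def potential_neg_def Z_def)
    have p: "p \<zeta> = pdf \<zeta>" if "\<zeta> \<in> \<Omega>" for \<zeta>
      using Z_pos[OF that]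
      by (auto simp: p pdf_def density_neg_def potential_neg_def Z_def exp_minus divide_inverse)
    show "L_div_neg \<alpha> \<phi> \<xi> \<xi>' = renyi_divergence \<mu> (1 - \<alpha>) (p \<xi>') (p \<xi>)"
      using L_div_neg_potential[OF that(2,3)]
      by (simp add: \<phi> p that(2,3) renyi_divergence_def overlap_def mult.commute)
    \<comment> \<open>Here \<open>overlap\<close> is read as the integral of order \<alpha>; the
      factor (\<alpha> - 1)/\<alpha> trades the prefactor 1/(\<alpha> - 1) for 1/\<alpha>.\<close>
    show "L_div_pos \<alpha> \<phi> \<xi> \<xi>' = (\<alpha> - 1) / \<alpha> * renyi_divergence \<mu> \<alpha> (p \<xi>) (p \<xi>')" if "1 < \<alpha>"
      using L_div_pos_potential[OF \<open>\<xi> \<in> \<Omega>\<close> \<open>\<xi>' \<in> \<Omega>\<close>] that \<open>\<xi> \<in> \<Omega>\<close> \<open>\<xi>' \<in> \<Omega>\<close>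
      by (simp add: \<phi> p renyi_divergence_def overlap_def)
    show "alpha_conjugate \<alpha> \<Omega> \<phi> (alpha_gradient \<alpha> \<phi> \<xi>) =
        - (1 / \<alpha>) * ln (\<integral>x. p \<xi> x powr (1 - \<alpha>) \<partial>\<mu>)"
      using alpha_conjugate_potential[OF that(2)] by (simp add: \<phi> p that(2,3) moment_def)
  qed
  \<comment> \<open>For \<alpha> < 1 the third fact in \<open>neg\<close> is the entropy formula,
    since 1/(1 - (1 - \<alpha>)) = 1/\<alpha>.\<close>
  show ?thesis
    unfolding Let_def using pos neg by (auto simp: renyi_entropy_def)
qed

end
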